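(* Every proper, geodesic Ptolemy metric space is strictly distance convex.
   Context: $|xy|$ denotes the distance between $x$ and $y$. A metric space $X$ is a Ptolemy metric space if $|xy|\,|uv| \le |xu|\,|yv| + |xv|\,|yu|$ for all $x,y,u,v \in X$. A geodesic in $X$ is a map $c: I \to X$, $I \subset \mathbb{R}$ an interval, such that for some constant $\lambda \ge 0$, $|c(t)c(s)| = \lambda|t-s|$ for all $s,t \in I$. $X$ is geodesic if every pair of points can be joined by a geodesic. $X$ is proper if all closed distance balls are compact. A geodesic metric space $X$ is strictly distance convex if for every $p \in X$ and every geodesic $c: I \to X$ satisfying $|c(t)\,c(s)| > \big||p\,c(t)| - |p\,c(s)|\big|$ for all $s,t \in I$ with $s \neq t$, the function $t \mapsto |p\,c(t)|$ is strictly convex on $I$. *)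

theory Defs
  imports "HOL-Analysis.Analysis"
begin

text \<open>
  A metric space is a subset \<open>X\<close> of a type of class \<^class>\<open>metric_space\<close>, with the
  restricted distance; \<open>X = UNIV\<close> covers an arbitrary (nonempty) metric space.
\<close>

definition ptolemy_space :: "'a::metric_space set \<Rightarrow> bool" where
  "ptolemy_space X \<longleftrightarrow>
     (\<forall>x\<in>X. \<forall>y\<in>X. \<forall>u\<in>X. \<forall>v\<in>X.
        dist x y * dist u v \<le> dist x u * dist y v + dist x v * dist y u)"

definition geodesic_on :: "'a::metric_space set \<Rightarrow> real set \<Rightarrow> (real \<Rightarrow> 'a) \<Rightarrow> bool" where
  "geodesic_on X I c \<longleftrightarrow>
     is_interval I \<and> c ` I \<subseteq> X \<and>
     (\<exists>l\<ge>0. \<forall>s\<in>I. \<forall>t\<in>I. dist (c t) (c s) = l * \<bar>t - s\<bar>)"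

definition geodesic_space :: "'a::metric_space set \<Rightarrow> bool" where
  "geodesic_space X \<longleftrightarrow>
     (\<forall>x\<in>X. \<forall>y\<in>X. \<exists>a b c. a \<le> b \<and> geodesic_on X {a..b} c \<and> c a = x \<and> c b = y)"

text \<open>The closed balls of the subspace \<open>X\<close> are the sets \<open>cball x r \<inter> X\<close> with \<open>x \<in> X\<close>.\<close>

definition proper_space :: "'a::metric_space set \<Rightarrow> bool" where
  "proper_space X \<longleftrightarrow> (\<forall>x\<in>X. \<forall>r. compact (cball x r \<inter> X))"

definition strictly_convex_on :: "'a::real_vector set \<Rightarrow> ('a \<Rightarrow> real) \<Rightarrow> bool" where
  "strictly_convex_on S f \<longleftrightarrow>
     convex S \<and>
     (\<forall>x\<in>S. \<forall>y\<in>S. \<forall>u>0. \<forall>v>0. x \<noteq> y \<longrightarrow> u + v = 1 \<longrightarrow>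
        f (u *\<^sub>R x + v *\<^sub>R y) < u * f x + v * f y)"

definition strictly_distance_convex :: "'a::metric_space set \<Rightarrow> bool" where
  "strictly_distance_convex X \<longleftrightarrow>
     geodesic_space X \<and>
     (\<forall>p\<in>X. \<forall>I c. geodesic_on X I c \<longrightarrow>
        (\<forall>s\<in>I. \<forall>t\<in>I. s \<noteq> t \<longrightarrow> dist (c t) (c s) > \<bar>dist p (c t) - dist p (c s)\<bar>) \<longrightarrow>
        strictly_convex_on I (\<lambda>t. dist p (c t)))"

end

theory Submission
  imports Defs "HOL-Real_Asymp.Real_Asymp"
begin

text \<open>
  Ptolemy's inequality makes distance functions convex along geodesics, so only strictness at
  midpoints is at stake. Suppose \<open>\<bar>p x\<bar> - \<bar>p x'\<bar>\<close> is smaller than \<open>L = \<bar>x x'\<bar>\<close> in absolute value,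
  while \<open>p\<close> has distance \<open>(\<bar>p x\<bar> + \<bar>p x'\<bar>) / 2\<close> from every midpoint of \<open>x, x'\<close>. Let \<open>z\<close> tend to
  \<open>x\<close> along a geodesic from \<open>x\<close> to \<open>p\<close>. By properness some midpoints of \<open>z, x'\<close> accumulate at a
  midpoint \<open>y\<close> of \<open>x, x'\<close>, and Ptolemy's inequality for the two midpoints and \<open>x, z\<close> shows that
  the distances to \<open>y\<close> and to \<open>x'\<close> have the same derivative \<open>B\<close> at \<open>x\<close> in the direction of \<open>p\<close>.
  Differentiating Ptolemy's inequality for \<open>z, y, x', p\<close>, which is an equality at \<open>z = x\<close>, yields
  \<open>L \<le> B (\<bar>p x'\<bar> - \<bar>p x\<bar>)\<close>, a contradiction since \<open>\<bar>B\<bar> \<le> 1\<close>.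
  Applied to two different midpoints of a pair \<open>u, v\<close> and \<open>p = u\<close>, this shows that midpoints are
  unique; applied again, it gives strict convexity.
\<close>

text \<open>Purely metric midpoints, with no geodesic chosen: the two equations survive limits of
  midpoints whose endpoints vary.\<close>

definition midpoints :: "'a::metric_space set \<Rightarrow> 'a \<Rightarrow> 'a \<Rightarrow> 'a set" where
  "midpoints X x y = {m \<in> X. dist x m = dist x y / 2 \<and> dist y m = dist x y / 2}"

lemma geodesic_space_point:
  assumes "geodesic_space X" "x \<in> X" "y \<in> X" "0 \<le> s" "s \<le> dist x y"
  obtains z where "z \<in> X" "dist x z = s" "dist z y = dist x y - s"
proof (cases "s = 0")
  case True
  then show ?thesis using assms that[of x] by simp
next
  case False
  obtain a b c where ab: "a \<le> b" and c: "geodesic_on X {a..b} c" "c a = x" "c b = y"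
    using assms(1-3) unfolding geodesic_space_def by blast
  then obtain l where l: "l \<ge> 0"
    "\<And>s t. s \<in> {a..b} \<Longrightarrow> t \<in> {a..b} \<Longrightarrow> dist (c t) (c s) = l * \<bar>t - s\<bar>"
    and cX: "c ` {a..b} \<subseteq> X"
    unfolding geodesic_on_def by blast
  have xy: "dist x y = l * (b - a)"
    using l(2)[of b a] ab c by simp
  \<comment> \<open>A constant geodesic has \<open>l = 0\<close>; with \<open>s = 0\<close> split
    off, \<open>x\<close> and \<open>y\<close> are distinct, so \<open>l\<close> can be divided
    by.\<close>
  then have lpos: "l > 0"
    using False assms(4,5) l(1) by (cases "l = 0") auto
  define t where "t = a + s / l"
  have t: "t \<in> {a..b}"
    using assms(4,5) lpos xy unfolding t_def by (simp add: field_simps)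
  show ?thesis
  proof
    show "c t \<in> X" using t cX by blast
    show "dist x (c t) = s"
      using l(2)[of t a] t ab c lpos assms(4) by (simp add: t_def)
    have "dist (c t) y = l * (b - t)"
      using l(2)[of b t] t c by simp
    also have "\<dots> = dist x y - s"
      using lpos unfolding t_def xy by (simp add: field_simps)
    finally show "dist (c t) y = dist x y - s" .
  qed
qed

lemma midpoints_nonempty:
  assumes "geodesic_space X" "x \<in> X" "y \<in> X"
  shows "midpoints X x y \<noteq> {}"
proof -
  obtain z where "z \<in> X" "dist x z = dist x y / 2" "dist z y = dist x y - dist x y / 2"
    using geodesic_space_point[OF assms, of "dist x y / 2"] by auto
  then have "z \<in> midpoints X x y"
    by (simp add: midpoints_def dist_commute)
  then show ?thesis by blast
qed

lemma ptolemyD: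
  assumes "ptolemy_space X" "x \<in> X" "y \<in> X" "u \<in> X" "v \<in> X"
  shows "dist x y * dist u v \<le> dist x u * dist y v + dist x v * dist y u"
  using assms unfolding ptolemy_space_def by blast

lemma midpoint_dist_le:
  assumes "ptolemy_space X" "p \<in> X" "x \<in> X" "y \<in> X" "m \<in> midpoints X x y"
  shows "dist p m \<le> (dist p x + dist p y) / 2"
proof (cases "x = y")
  case True
  then show ?thesis using assms(5) by (simp add: midpoints_def)
next
  case False
  have m: "dist m x = dist x y / 2" "dist m y = dist x y / 2"
    using assms(5) by (simp_all add: midpoints_def dist_commute)
  have "dist p m * dist x y \<le> dist p x * dist m y + dist p y * dist m x"
    using assms by (intro ptolemyD) (auto simp: midpoints_def)
  also have "\<dots> = (dist p x + dist p y) / 2 * dist x y"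
    unfolding m by (simp add: field_simps)
  finally show ?thesis
    using False by (simp add: mult_le_cancel_right)
qed

lemma proper_space_convergent_subseq:
  assumes "proper_space X" "x \<in> X" "\<And>n. y n \<in> X" "\<And>n. dist x (y n) \<le> r"
  obtains l \<phi> where "l \<in> X" "strict_mono (\<phi> :: nat \<Rightarrow> nat)" "(y \<circ> \<phi>) \<longlonglongrightarrow> l"
proof -
  have "seq_compact (cball x r \<inter> X)"
    using assms(1,2) by (auto simp: proper_space_def compact_imp_seq_compact)
  then obtain l \<phi> where "l \<in> cball x r \<inter> X" "strict_mono (\<phi> :: nat \<Rightarrow> nat)" "(y \<circ> \<phi>) \<longlonglongrightarrow> l"
    using assms(3,4) unfolding seq_compact_def by (metis IntI mem_cball)
  then show ?thesis using that by blast
qed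

text \<open>The derivative comparison in finite form: \<open>d\<close> and \<open>k\<close> below
  are the increments of the distances to \<open>x'\<close> and \<open>y\<close> when
  \<open>x\<close> moves to \<open>z\<close>, so no derivative has to exist. The last summand is the
  error left after division by \<open>s\<close>; it vanishes as \<open>s\<close> tends to 0 and
  \<open>w\<close> to \<open>y\<close>.\<close>

lemma ptolemy_midpoint_estimate:
  assumes pt: "ptolemy_space X"
    and X: "p \<in> X" "x \<in> X" "x' \<in> X" "z \<in> X"
    and z: "dist x z = s" "dist p z = dist p x - s" "0 < s"
    and w: "w \<in> midpoints X z x'"
    and y: "y \<in> midpoints X x x'" "dist p y = (dist p x + dist p x') / 2"
  shows "(dist x x')\<^sup>2 \<le>
    dist x x' * \<bar>dist p x - dist p x'\<bar> + 4 * dist p x' * (dist y w + s / 2)"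
proof -
  define L where "L = dist x x'"
  define f g where "f = dist p x" and "g = dist p x'"
  define d where "d = dist z x' - L"
  define k where "k = dist y z - L / 2"
  have yX: "y \<in> X" "dist x y = L / 2" "dist x' y = L / 2"
    and wX: "w \<in> X" "dist z w = (L + d) / 2" "dist x' w = (L + d) / 2"
    using y w by (auto simp: midpoints_def L_def d_def)
  have ds: "\<bar>d\<bar> \<le> s"
    using z(1) dist_triangle[of z x' x] dist_triangle[of x x' z]
    unfolding d_def L_def by (simp add: dist_commute)
  have ks: "\<bar>k\<bar> \<le> s"
    using z(1) yX(2) dist_triangle[of y z x] dist_triangle[of x y z]
    unfolding k_def by (simp add: dist_commute)
  \<comment> \<open>Needed for Ptolemy with the pairs \<open>y\<close>, \<open>z\<close> and
    \<open>w\<close>, \<open>x\<close>: the terms of order zero cancel, and \<open>k - d\<close> is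
    bounded above by a small multiple of \<open>s\<close>.\<close>
  have "L / 2 - d / 2 \<le> dist w x"
    using dist_triangle[of x x' w] wX(3) by (simp add: L_def dist_commute field_simps)
  then have "(L / 2 + k) * (L / 2 - d / 2) \<le> dist y z * dist w x"
    unfolding k_def by (simp add: mult_left_mono)
  also have "\<dots> \<le> s * dist y w + L / 2 * ((L + d) / 2)"
    using ptolemyD[OF pt yX(1) X(4) wX(1) X(2)]
    unfolding wX(2) dist_commute[of y x] dist_commute[of z x] yX(2) z(1)
    by (simp add: mult.commute)
  finally have "L / 2 * (k - d) \<le> s * dist y w + k * d / 2"
    by (simp add: field_simps)
  moreover have "k * d \<le> s * s"
    using mult_mono[OF ks ds] z(3) abs_ge_self[of "k * d"] by (simp add: abs_mult)
  ultimately have 1: "L / 2 * (k - d) \<le> s * (dist y w + s / 2)"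
    by (simp add: distrib_left)
  \<comment> \<open>Ptolemy with the pairs \<open>z\<close>, \<open>x'\<close> and \<open>y\<close>,
    \<open>p\<close>. By the assumed value of \<open>dist p y\<close>, both sides agree when
    \<open>s\<close>, \<open>d\<close> and \<open>k\<close> are 0, so only increments
    remain.\<close>
  have "(L + d) * ((f + g) / 2) \<le> (L / 2 + k) * g + L / 2 * (f - s)"
    using ptolemyD[OF pt X(4) X(3) yX(1) X(1)] y(2) z yX(3)
    by (simp add: dist_commute mult_ac f_def g_def d_def k_def)
  then have "s * L / 2 \<le> g * (k - d) + d * (g - f) / 2"
    by (simp add: field_simps)
  \<comment> \<open>The factor \<open>L / 2\<close> makes fact \<open>1\<close> applicable without
    dividing by \<open>L\<close>.\<close>
  then have "L / 2 * (s * L / 2) \<le> L / 2 * (g * (k - d) + d * (g - f) / 2)"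
    by (rule mult_left_mono) (simp add: L_def)
  then have "s * L\<^sup>2 \<le> 4 * (g * (L / 2 * (k - d))) + L * (d * (g - f))"
    by (simp add: field_simps power2_eq_square)
  also have "\<dots> \<le> 4 * (g * (s * (dist y w + s / 2))) + L * (s * \<bar>f - g\<bar>)"
  proof (intro add_mono mult_left_mono)
    show "L / 2 * (k - d) \<le> s * (dist y w + s / 2)"
      by (fact 1)
    show "d * (g - f) \<le> s * \<bar>f - g\<bar>"
      using mult_right_mono[OF ds, of "\<bar>g - f\<bar>"] abs_ge_self[of "d * (g - f)"]
      by (simp add: abs_mult abs_minus_commute)
  qed (simp_all add: L_def g_def)
  finally have "s * L\<^sup>2 \<le> s * (L * \<bar>f - g\<bar> + 4 * g * (dist y w + s / 2))"
    by (simp add: algebra_simps)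
  then show ?thesis
    using z(3) by (simp add: L_def f_def g_def mult_le_cancel_left)
qed

text \<open>Only some midpoint is obtained: the limit \<open>y\<close> of the \<open>w n\<close>
  cannot be prescribed, so the argument needs equality at every midpoint.\<close>

lemma exists_midpoint_dist_less:
  assumes pr: "proper_space X" and ge: "geodesic_space X" and pt: "ptolemy_space X"
    and X: "p \<in> X" "x \<in> X" "x' \<in> X"
    and less: "\<bar>dist p x - dist p x'\<bar> < dist x x'"
  shows "\<exists>y\<in>midpoints X x x'. dist p y < (dist p x + dist p x') / 2"
proof (rule ccontr)
  assume "\<not> ?thesis"
  then have eq: "dist p y = (dist p x + dist p x') / 2" if "y \<in> midpoints X x x'" for y
    using that midpoint_dist_le[OF pt X that] by force
  \<comment> \<open>For \<open>p = x\<close> both sides of \<open>less\<close> would coincide; hence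
    there is room to move from \<open>x\<close> towards \<open>p\<close>.\<close>
  have px: "dist p x > 0"
    using less by auto
  define s where "s n = dist p x / Suc n" for n
  have s: "0 < s n" "s n \<le> dist p x" for n
    using px by (auto simp: s_def field_simps mult_left_mono)
  have s0: "s \<longlonglongrightarrow> 0"
    unfolding s_def by real_asymp
  have "\<exists>z\<in>X. dist x z = s n \<and> dist p z = dist p x - s n" for n
    using geodesic_space_point[OF ge X(2,1), of "s n"] s[of n] by (metis dist_commute less_imp_le)
  then obtain z where z: "\<And>n. z n \<in> X" "\<And>n. dist x (z n) = s n"
      "\<And>n. dist p (z n) = dist p x - s n"
    by metis
  have "\<exists>w. w \<in> midpoints X (z n) x'" for n
    using midpoints_nonempty[OF ge z(1) X(3)] by blast
  then obtain w where w: "\<And>n. w n \<in> midpoints X (z n) x'"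
    by metis
  then have w': "w n \<in> X" "dist (z n) (w n) = dist (z n) x' / 2"
      "dist x' (w n) = dist (z n) x' / 2" for n
    by (auto simp: midpoints_def)
  \<comment> \<open>A bound independent of \<open>n\<close>, so that properness gives a convergent
    subsequence.\<close>
  have "dist x' (w n) \<le> dist x x' + dist p x" for n
    using w'(3)[of n] dist_triangle[of "z n" x' x] z(2)[of n] s(2)[of n]
      zero_le_dist[of x x'] zero_le_dist[of p x] dist_commute[of "z n" x]
    by linarith
  then obtain y \<phi> where y: "y \<in> X" "strict_mono (\<phi> :: nat \<Rightarrow> nat)" "(w \<circ> \<phi>) \<longlonglongrightarrow> y"
    using proper_space_convergent_subseq[of X x' w] pr X(3) w'(1) by blast
  have "z \<longlonglongrightarrow> x"
    using s0 z(2) by (subst tendsto_dist_iff) (simp add: dist_commute)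
  then have zx: "(z \<circ> \<phi>) \<longlonglongrightarrow> x"
    using y(2) by (rule LIMSEQ_subseq_LIMSEQ)
  have s\<phi>: "(\<lambda>n. s (\<phi> n)) \<longlonglongrightarrow> 0"
    using LIMSEQ_subseq_LIMSEQ[OF s0 y(2)] by (simp add: o_def)
  have lim2: "(\<lambda>n. dist (z (\<phi> n)) x' / 2) \<longlonglongrightarrow> dist x x' / 2"
    using zx unfolding o_def by (intro tendsto_intros) auto
  have "(\<lambda>n. dist (z (\<phi> n)) (w (\<phi> n))) \<longlonglongrightarrow> dist x y"
       "(\<lambda>n. dist x' (w (\<phi> n))) \<longlonglongrightarrow> dist x' y"
    using zx y(3) unfolding o_def by (auto intro!: tendsto_intros)
  then have "dist x y = dist x x' / 2" "dist x' y = dist x x' / 2"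
    unfolding w'(2,3) using lim2 LIMSEQ_unique by blast+
  then have ym: "y \<in> midpoints X x x'"
    using y(1) by (simp add: midpoints_def)
  have "(dist x x')\<^sup>2 \<le> dist x x' * \<bar>dist p x - dist p x'\<bar>
      + 4 * dist p x' * (dist y (w (\<phi> n)) + s (\<phi> n) / 2)" for n
    using ptolemy_midpoint_estimate[OF pt X z s(1) w ym eq[OF ym]] .
  moreover have "(\<lambda>n. dist x x' * \<bar>dist p x - dist p x'\<bar>
      + 4 * dist p x' * (dist y (w (\<phi> n)) + s (\<phi> n) / 2))
      \<longlonglongrightarrow> dist x x' * \<bar>dist p x - dist p x'\<bar> + 4 * dist p x' * (dist y y + 0 / 2)"
    using y(3) s\<phi> unfolding o_def by (intro tendsto_intros) auto
  ultimately have "(dist x x')\<^sup>2 \<le> dist x x' * \<bar>dist p x - dist p x'\<bar>"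
    using LIMSEQ_le_const by fastforce
  then have "dist x x' \<le> \<bar>dist p x - dist p x'\<bar>"
    using less by (simp add: power2_eq_square mult_le_cancel_left)
  then show False
    using less by simp
qed

text \<open>A suitable midpoint \<open>y\<close> of two distinct midpoints would be strictly closer
  to \<open>u\<close> than \<open>dist u v / 2\<close>, yet no farther than that from
  \<open>v\<close>, against the triangle inequality.\<close>

lemma midpoints_unique:
  assumes "proper_space X" "geodesic_space X" and pt: "ptolemy_space X"
    and X: "u \<in> X" "v \<in> X" and m: "m \<in> midpoints X u v" "n \<in> midpoints X u v"
  shows "m = n"
proof (rule ccontr)
  assume "m \<noteq> n"
  have mn: "m \<in> X" "n \<in> X" "dist u m = dist u v / 2" "dist u n = dist u v / 2"
      "dist v m = dist u v / 2" "dist v n = dist u v / 2"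
    using m by (auto simp: midpoints_def)
  have "\<bar>dist u m - dist u n\<bar> < dist m n"
    unfolding mn(3,4) using \<open>m \<noteq> n\<close> by simp
  then obtain y where y: "y \<in> midpoints X m n" "dist u y < dist u v / 2"
    using exists_midpoint_dist_less[OF assms(1-3) X(1) mn(1,2)] mn(3,4) by auto
  moreover have "dist v y \<le> dist u v / 2"
    using midpoint_dist_le[OF pt X(2) mn(1,2) y(1)] mn by simp
  ultimately show False
    using dist_triangle[of u v y] by (simp add: dist_commute)
qed

lemma midpoint_dist_less:
  assumes "proper_space X" "geodesic_space X" "ptolemy_space X"
    and "p \<in> X" "x \<in> X" "y \<in> X" "m \<in> midpoints X x y"
    and "\<bar>dist p x - dist p y\<bar> < dist x y"
  shows "dist p m < (dist p x + dist p y) / 2"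
  using exists_midpoint_dist_less[of X p x y] midpoints_unique[of X x y m] assms by blast

text \<open>By symmetry the weight of \<open>x\<close> is at most that of \<open>y\<close>. The
  point then lies between the midpoint and \<open>y\<close>, and convexity there passes on the
  strict inequality with the positive weight \<open>2 * u\<close>.\<close>

lemma strictly_convex_onI_midpoint:
  fixes f :: "'a::real_vector \<Rightarrow> real"
  assumes f: "convex_on S f"
    and mid: "\<And>x y. x \<in> S \<Longrightarrow> y \<in> S \<Longrightarrow> x \<noteq> y \<Longrightarrow>
      f ((1/2) *\<^sub>R (x + y)) < (f x + f y) / 2"
  shows "strictly_convex_on S f"
proof -
  have S: "convex S"
    using f by (rule convex_on_imp_convex)
  have *: "f (u *\<^sub>R x + v *\<^sub>R y) < u * f x + v * f y"
    if x: "x \<in> S" and y: "y \<in> S" and uv: "0 < u" "u \<le> v" "u + v = 1" and "x \<noteq> y" for x y u v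
  proof -
    define m where "m = (1/2) *\<^sub>R (x + y)"
    have mS: "m \<in> S"
      using convexD[OF S x y, of "1/2" "1/2"] by (simp add: m_def scaleR_add_right)
    have v: "v = 1 - u"
      using uv by simp
    have "u *\<^sub>R x + v *\<^sub>R y = (2 * u) *\<^sub>R m + (1 - 2 * u) *\<^sub>R y"
      by (simp add: m_def v algebra_simps flip: scaleR_2)
    then have "f (u *\<^sub>R x + v *\<^sub>R y) \<le> (2 * u) * f m + (1 - 2 * u) * f y"
      using convex_onD[OF f, of "1 - 2 * u" m y] mS y uv by simp
    also have "\<dots> < (2 * u) * ((f x + f y) / 2) + (1 - 2 * u) * f y"
      using mid[OF x y \<open>x \<noteq> y\<close>] uv by (simp add: m_def)
    also have "\<dots> = u * f x + v * f y"
      by (simp add: v field_simps)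
    finally show ?thesis .
  qed
  show ?thesis
    unfolding strictly_convex_on_def
  proof (intro conjI ballI allI impI)
    fix x y u v assume "x \<in> S" "y \<in> S" "u > (0::real)" "v > (0::real)" "x \<noteq> y" "u + v = 1"
    then show "f (u *\<^sub>R x + v *\<^sub>R y) < u * f x + v * f y"
      using *[of x y u v] *[of y x v u] by (cases "u \<le> v") (auto simp: add.commute)
  qed (fact S)
qed

theorem theorem1p5:
  fixes X :: "'a::metric_space set"
  assumes "proper_space X" and "geodesic_space X" and "ptolemy_space X"
  shows "strictly_distance_convex X"
  unfolding strictly_distance_convex_def
proof (intro conjI ballI allI impI)
  fix p I c
  assume p: "p \<in> X" and c: "geodesic_on X I c"
    and less: "\<forall>s\<in>I. \<forall>t\<in>I. s \<noteq> t \<longrightarrow> \<bar>dist p (c t) - dist p (c s)\<bar> < dist (c t) (c s)"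
  obtain l where l: "l \<ge> 0" "\<And>s t. s \<in> I \<Longrightarrow> t \<in> I \<Longrightarrow> dist (c t) (c s) = l * \<bar>t - s\<bar>"
    and cX: "c ` I \<subseteq> X" and "is_interval I"
    using c unfolding geodesic_on_def by blast
  then have I: "convex I"
    by (simp add: is_interval_convex)
  have "convex_on I (\<lambda>t. dist p (c t))"
  proof (rule convex_onI)
    fix u s t :: real
    assume u: "0 < u" "u < 1" and st: "s \<in> I" "t \<in> I"
    define r where "r = (1 - u) *\<^sub>R s + u *\<^sub>R t"
    have r: "r \<in> I"
      using I st u unfolding r_def by (intro convexD) auto
    have "dist p (c r) \<le> (1 - u) * dist p (c s) + u * dist p (c t)"
    proof (cases "s = t")
      case True
      then show ?thesis by (simp add: r_def algebra_simps)
    next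
      case False
      \<comment> \<open>The hypothesis on \<open>c\<close> excludes constant geodesics here, so
        Ptolemy's inequality for \<open>p\<close>, \<open>c r\<close>, \<open>c s\<close>,
        \<open>c t\<close> can be divided by this distance.\<close>
      have pos: "dist (c s) (c t) > 0"
        using less st False by (metis abs_ge_zero dist_commute order_le_less_trans)
      have "r - s = u * (t - s)" "r - t = (1 - u) * (s - t)"
        by (simp_all add: r_def algebra_simps)
      then have rs: "dist (c r) (c s) = u * dist (c s) (c t)"
          and rt: "dist (c r) (c t) = (1 - u) * dist (c s) (c t)"
        using u l(2) st r by (simp_all add: abs_mult abs_minus_commute)
      have "dist p (c r) * dist (c s) (c t)
          \<le> dist p (c s) * dist (c r) (c t) + dist p (c t) * dist (c r) (c s)"
        using assms(3) p cX st r by (intro ptolemyD) auto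
      also have "\<dots> = ((1 - u) * dist p (c s) + u * dist p (c t)) * dist (c s) (c t)"
        unfolding rs rt by (simp add: algebra_simps)
      finally show ?thesis
        using pos by (simp add: mult_le_cancel_right)
    qed
    then show "dist p (c ((1 - u) *\<^sub>R s + u *\<^sub>R t)) \<le> (1 - u) * dist p (c s) + u * dist p (c t)"
      by (simp add: r_def)
  qed (fact I)
  then show "strictly_convex_on I (\<lambda>t. dist p (c t))"
  proof (rule strictly_convex_onI_midpoint)
    fix s t assume st: "s \<in> I" "t \<in> I" "s \<noteq> t"
    define r where "r = (1/2) *\<^sub>R (s + t)"
    have r: "r \<in> I"
      using convexD[OF I st(1,2), of "1/2" "1/2"] by (simp add: r_def add_divide_distrib)
    have "\<bar>r - s\<bar> = \<bar>t - s\<bar> / 2" "\<bar>r - t\<bar> = \<bar>t - s\<bar> / 2"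
      by (auto simp: r_def abs_if field_simps)
    then have "c r \<in> midpoints X (c s) (c t)"
      using l(2)[of s t] l(2)[OF st(1) r] l(2)[OF st(2) r] st r cX
      by (auto simp: midpoints_def dist_commute)
    then have "dist p (c r) < (dist p (c s) + dist p (c t)) / 2"
      using assms p cX st less by (intro midpoint_dist_less) auto
    then show "dist p (c ((1/2) *\<^sub>R (s + t))) < (dist p (c s) + dist p (c t)) / 2"
      by (simp add: r_def)
  qed
qed (fact assms(2))

end
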